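(* Let $(X,d_X,\mu_X)$ and $(Y,d_Y,\mu_Y)$ be complete, separable, locally compact, path-connected metric measure spaces, each containing more than one point, with $\operatorname{supp}\mu_X=X$, $\operatorname{supp}\mu_Y=Y$, and let $\varphi:X\to Y$ be a homeomorphism with $\varphi_*\mu_X=\mu_Y$. Let $A$ be a (partially defined) linear operator on $L^2(X,\mu_X)$ with domain $\mathscr D(A)$, and let $\varphi_{\mathbb L}A:=(\varphi^* )^{-1}\circ A\circ\varphi^*$ with domain $(\varphi^* )^{-1}(\mathscr D(A))\subseteq L^2(Y,\mu_Y)$, where $\varphi^*f=f\circ\varphi$. Then $A$ satisfies the Standing Assumptions on operators (on $X$) if and only if $\varphi_{\mathbb L}A$ satisfies them (on $Y$), and in that case $$\dim_{\mathcal S}(X,A)=\dim_{\mathcal S}(Y,\varphi_{\mathbb L}A)$$ (one spectral dimension existing if and only if the other does).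
   Context: A metric measure space is a complete separable metric space with a Radon measure; if the space is compact, the measure is assumed to be a probability measure. $\varphi_*\mu_X$ denotes the pushforward measure. $\varphi^*:L^2(Y,\mu_Y)\to L^2(X,\mu_X)$, $f\mapsto f\circ\varphi$, is an isometric isomorphism. Standing Assumptions on an operator $A:L^2(X,\mu)\supseteq\mathscr D(A)\to L^2(X,\mu)$: (1) $A$ is densely defined and self-adjoint. (2) The spectrum of $A$ is nonempty, contained in $[0,\infty)$, and has a single accumulation point at $+\infty$, so that the eigenvalues can be enumerated with multiplicity as $0\le\lambda_1\le\lambda_2\le\dots$ with $\lambda_n\nearrow\infty$. (3) $\mathscr D(\sqrt A)\cap C_c(X)$ is dense in $C_c(X)$ with respect to the supremum norm and dense in $\mathscr D(\sqrt A)$ with respect to the graph norm $\|f\|_{L^2}+\|\sqrt Af\|_{L^2}$, where $C_c(X)$ is the space of compactly supported continuous functions. (4) $-A$ is dissipative: $\|(\lambda+A)f\|\ge\lambda\|f\|$ for all $f\in\mathscr D(A)$, $\lambda>0$. Spectral dimension: with $N_A(x):=\max\{n\in\mathbb N:\lambda_n\le x\}$, $\dim_{\mathcal S}(X,A):=\lim_{x\to\infty}\frac{\log N_A(x)}{\log x}$ if the limit exists. *)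

theory Defs
  imports "HOL-Probability.Probability_Measure"
begin

section \<open>Metric measure spaces\<close>

text \<open>The underlying complete separable metric space is a type of class \<^class>\<open>polish_space\<close>.\<close>

definition radon_measure :: "'a::topological_space measure \<Rightarrow> bool" where
  "radon_measure M \<longleftrightarrow> sets M = sets borel \<and>
     (\<forall>x. \<exists>U. open U \<and> x \<in> U \<and> emeasure M U < \<infinity>) \<and>
     (\<forall>B \<in> sets borel. emeasure M B = (SUP K \<in> {K. compact K \<and> K \<subseteq> B}. emeasure M K))"

definition metric_measure_space :: "'a::polish_space measure \<Rightarrow> bool" where
  "metric_measure_space M \<longleftrightarrow> radon_measure M \<and> (compact (UNIV :: 'a set) \<longrightarrow> prob_space M)"

definition measure_support :: "'a::topological_space measure \<Rightarrow> 'a set" where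
  "measure_support M = {x. \<forall>U. open U \<longrightarrow> x \<in> U \<longrightarrow> emeasure M U > 0}"

section \<open>The complex Hilbert space of square-integrable functions modulo null sets\<close>

type_synonym 'a l2 = "('a \<Rightarrow> complex) set"

definition square_integrable :: "'a measure \<Rightarrow> ('a \<Rightarrow> complex) \<Rightarrow> bool" where
  "square_integrable M f \<longleftrightarrow> f \<in> borel_measurable M \<and> integrable M (\<lambda>x. (cmod (f x))\<^sup>2)"

definition l2_class :: "'a measure \<Rightarrow> ('a \<Rightarrow> complex) \<Rightarrow> 'a l2" where
  "l2_class M f = {g \<in> borel_measurable M. AE x in M. g x = f x}"

definition L2 :: "'a measure \<Rightarrow> 'a l2 set" where
  "L2 M = {l2_class M f | f. square_integrable M f}"

definition l2_rep :: "'a l2 \<Rightarrow> 'a \<Rightarrow> complex" where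
  "l2_rep u = (SOME f. f \<in> u)"

definition l2_zero :: "'a measure \<Rightarrow> 'a l2" where
  "l2_zero M = l2_class M (\<lambda>x. 0)"

definition l2_add :: "'a measure \<Rightarrow> 'a l2 \<Rightarrow> 'a l2 \<Rightarrow> 'a l2" where
  "l2_add M u v = l2_class M (\<lambda>x. l2_rep u x + l2_rep v x)"

definition l2_diff :: "'a measure \<Rightarrow> 'a l2 \<Rightarrow> 'a l2 \<Rightarrow> 'a l2" where
  "l2_diff M u v = l2_class M (\<lambda>x. l2_rep u x - l2_rep v x)"

definition l2_scale :: "'a measure \<Rightarrow> complex \<Rightarrow> 'a l2 \<Rightarrow> 'a l2" where
  "l2_scale M c u = l2_class M (\<lambda>x. c * l2_rep u x)"

definition l2_lincomb :: "'a measure \<Rightarrow> nat \<Rightarrow> (nat \<Rightarrow> complex) \<Rightarrow> (nat \<Rightarrow> 'a l2) \<Rightarrow> 'a l2" where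
  "l2_lincomb M k c e = l2_class M (\<lambda>x. \<Sum>i<k. c i * l2_rep (e i) x)"

definition l2_inner :: "'a measure \<Rightarrow> 'a l2 \<Rightarrow> 'a l2 \<Rightarrow> complex" where
  "l2_inner M u v = (LINT x|M. l2_rep u x * cnj (l2_rep v x))"

definition l2_norm :: "'a measure \<Rightarrow> 'a l2 \<Rightarrow> real" where
  "l2_norm M u = sqrt (LINT x|M. (cmod (l2_rep u x))\<^sup>2)"

section \<open>Partially defined linear operators\<close>

text \<open>A partially defined operator is a partial map; its domain is \<^const>\<open>dom\<close>.\<close>

type_synonym 'a l2_op = "'a l2 \<rightharpoonup> 'a l2"

definition linear_operator :: "'a measure \<Rightarrow> 'a l2_op \<Rightarrow> bool" where
  "linear_operator M A \<longleftrightarrow>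
     dom A \<subseteq> L2 M \<and> ran A \<subseteq> L2 M \<and> l2_zero M \<in> dom A \<and>
     (\<forall>u \<in> dom A. \<forall>v \<in> dom A. A (l2_add M u v) = Some (l2_add M (the (A u)) (the (A v)))) \<and>
     (\<forall>c. \<forall>u \<in> dom A. A (l2_scale M c u) = Some (l2_scale M c (the (A u))))"

definition densely_defined :: "'a measure \<Rightarrow> 'a l2_op \<Rightarrow> bool" where
  "densely_defined M A \<longleftrightarrow> (\<forall>u \<in> L2 M. \<forall>e>0. \<exists>v \<in> dom A. l2_norm M (l2_diff M u v) < e)"

text \<open>If \<open>A\<close> is densely defined, there is at most one \<open>h\<close> as below.\<close>

definition adjoint_op :: "'a measure \<Rightarrow> 'a l2_op \<Rightarrow> 'a l2_op" where
  "adjoint_op M A = (\<lambda>g.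
     let P = (\<lambda>h. h \<in> L2 M \<and> (\<forall>f \<in> dom A. l2_inner M (the (A f)) g = l2_inner M f h))
     in if g \<in> L2 M \<and> (\<exists>!h. P h) then Some (THE h. P h) else None)"

definition self_adjoint :: "'a measure \<Rightarrow> 'a l2_op \<Rightarrow> bool" where
  "self_adjoint M A \<longleftrightarrow> adjoint_op M A = A"

definition resolvent_set :: "'a measure \<Rightarrow> 'a l2_op \<Rightarrow> complex set" where
  "resolvent_set M A = {z.
     bij_betw (\<lambda>f. l2_diff M (l2_scale M z f) (the (A f))) (dom A) (L2 M) \<and>
     (\<exists>C. \<forall>f \<in> dom A. l2_norm M f \<le> C * l2_norm M (l2_diff M (l2_scale M z f) (the (A f))))}"

definition spectrum :: "'a measure \<Rightarrow> 'a l2_op \<Rightarrow> complex set" where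
  "spectrum M A = - resolvent_set M A"

definition eigenspace :: "'a measure \<Rightarrow> 'a l2_op \<Rightarrow> complex \<Rightarrow> 'a l2 set" where
  "eigenspace M A z = {f \<in> dom A. A f = Some (l2_scale M z f)}"

text \<open>The subspace \<open>E\<close> has a basis with \<open>k\<close> elements.\<close>

definition has_dimension :: "'a measure \<Rightarrow> 'a l2 set \<Rightarrow> nat \<Rightarrow> bool" where
  "has_dimension M E k \<longleftrightarrow>
     (\<exists>e. (\<forall>i<k. e i \<in> E) \<and>
          (\<forall>c. l2_lincomb M k c e = l2_zero M \<longrightarrow> (\<forall>i<k. c i = 0)) \<and>
          (\<forall>u \<in> E. \<exists>c. u = l2_lincomb M k c e))"

text \<open>The sequence \<open>l\<close> is indexed from \<open>0\<close>, i.e. \<open>l n\<close> is the \<open>(n+1)\<close>-st eigenvalue.\<close>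

definition eigenvalue_enumeration :: "'a measure \<Rightarrow> 'a l2_op \<Rightarrow> (nat \<Rightarrow> real) \<Rightarrow> bool" where
  "eigenvalue_enumeration M A l \<longleftrightarrow>
     incseq l \<and> filterlim l at_top sequentially \<and>
     (\<forall>x. has_dimension M (eigenspace M A (complex_of_real x)) (card {n. l n = x}))"

text \<open>
  The positive self-adjoint square root. \<open>B \<circ>\<^sub>m B\<close> carries the natural domain of the
  square, and the square root exists and is unique for every positive self-adjoint operator.
\<close>

definition is_positive_sqrt :: "'a measure \<Rightarrow> 'a l2_op \<Rightarrow> 'a l2_op \<Rightarrow> bool" where
  "is_positive_sqrt M A B \<longleftrightarrow>
     linear_operator M B \<and> densely_defined M B \<and> self_adjoint M B \<and>
     (\<forall>f \<in> dom B. Re (l2_inner M (the (B f)) f) \<ge> 0) \<and> B \<circ>\<^sub>m B = A"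

definition sqrt_op :: "'a measure \<Rightarrow> 'a l2_op \<Rightarrow> 'a l2_op" where
  "sqrt_op M A =
     (if \<exists>!B. is_positive_sqrt M A B then THE B. is_positive_sqrt M A B else Map.empty)"

section \<open>The standing assumptions\<close>

definition C_c :: "('a::topological_space \<Rightarrow> complex) set" where
  "C_c = {f. continuous_on UNIV f \<and> compact (closure {x. f x \<noteq> 0})}"

definition graph_norm :: "'a measure \<Rightarrow> 'a l2_op \<Rightarrow> 'a l2 \<Rightarrow> real" where
  "graph_norm M B u = l2_norm M u + l2_norm M (the (B u))"

text \<open>
  The accumulation points of the spectrum are taken in the extended real line. That the
  eigenvalues can be enumerated with multiplicity includes finiteness of the multiplicities.
\<close>

definition discrete_nonneg_spectrum :: "'a measure \<Rightarrow> 'a l2_op \<Rightarrow> bool" where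
  "discrete_nonneg_spectrum M A \<longleftrightarrow>
     spectrum M A \<noteq> {} \<and>
     spectrum M A \<subseteq> complex_of_real ` {0..} \<and>
     {a :: ereal. a islimpt ((\<lambda>z. ereal (Re z)) ` spectrum M A)} = {\<infinity>} \<and>
     (\<exists>l. eigenvalue_enumeration M A l)"

definition C_c_core :: "'a::topological_space measure \<Rightarrow> 'a l2_op \<Rightarrow> bool" where
  "C_c_core M B \<longleftrightarrow>
     (\<forall>f \<in> C_c. \<forall>e>0. \<exists>g \<in> C_c. l2_class M g \<in> dom B \<and> (SUP x. cmod (f x - g x)) < e) \<and>
     (\<forall>u \<in> dom B. \<forall>e>0. \<exists>g \<in> C_c. l2_class M g \<in> dom B \<and>
        graph_norm M B (l2_diff M u (l2_class M g)) < e)"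

definition dissipative_neg :: "'a measure \<Rightarrow> 'a l2_op \<Rightarrow> bool" where
  "dissipative_neg M A \<longleftrightarrow>
     (\<forall>f \<in> dom A. \<forall>l::real. l > 0 \<longrightarrow>
        l2_norm M (l2_add M (l2_scale M (complex_of_real l) f) (the (A f))) \<ge> l * l2_norm M f)"

definition standing_assumptions :: "'a::topological_space measure \<Rightarrow> 'a l2_op \<Rightarrow> bool" where
  "standing_assumptions M A \<longleftrightarrow>
     densely_defined M A \<and> self_adjoint M A \<and>
     discrete_nonneg_spectrum M A \<and>
     C_c_core M (sqrt_op M A) \<and>
     dissipative_neg M A"

section \<open>Spectral dimension\<close>

text \<open>The \<open>n\<close>-th eigenvalue, for \<open>n \<ge> 1\<close>.\<close>

definition eigenvalue :: "'a measure \<Rightarrow> 'a l2_op \<Rightarrow> nat \<Rightarrow> real" where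
  "eigenvalue M A n = (THE l. eigenvalue_enumeration M A l) (n - 1)"

text \<open>Only large \<open>x\<close> matter; the value for \<open>x\<close> below the first eigenvalue is irrelevant.\<close>

definition eigenvalue_count :: "'a measure \<Rightarrow> 'a l2_op \<Rightarrow> real \<Rightarrow> nat" where
  "eigenvalue_count M A x = Max {n. 1 \<le> n \<and> eigenvalue M A n \<le> x}"

text \<open>The limit is taken in the extended reals, so that the value \<open>\<infinity>\<close> is allowed.\<close>

definition has_spectral_dimension :: "'a measure \<Rightarrow> 'a l2_op \<Rightarrow> ereal \<Rightarrow> bool" where
  "has_spectral_dimension M A d \<longleftrightarrow>
     ((\<lambda>x. ereal (ln (real (eigenvalue_count M A x)) / ln x)) \<longlongrightarrow> d) at_top"

definition spectral_dimension :: "'a measure \<Rightarrow> 'a l2_op \<Rightarrow> ereal" where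
  "spectral_dimension M A = (THE d. has_spectral_dimension M A d)"

section \<open>Transport of operators\<close>

definition pullback :: "'a measure \<Rightarrow> ('a \<Rightarrow> 'b) \<Rightarrow> 'b l2 \<Rightarrow> 'a l2" where
  "pullback M \<phi> u = l2_class M (l2_rep u \<circ> \<phi>)"

definition transport_op ::
  "'a measure \<Rightarrow> 'b measure \<Rightarrow> ('a \<Rightarrow> 'b) \<Rightarrow> 'a l2_op \<Rightarrow> 'b l2_op" where
  "transport_op M N \<phi> A = (\<lambda>u.
     if u \<in> L2 N then map_option (inv_into (L2 N) (pullback M \<phi>)) (A (pullback M \<phi> u))
     else None)"

end

(*
  Composition with the inverse homeomorphism is a bijection between all sets of functions on the two
  spaces, not only between the L2 spaces. It carries every notion in the standing assumptions on one
  side to the same notion on the other; the only thing to check is that the operations on classes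
  do not depend on the representatives chosen by l2_rep.
*)
theory Submission
  imports Defs
begin

section \<open>Unique existence and definite descriptions along a bijection\<close>

lemma ex1_bij_iff:
  assumes "bij f"
  shows "(\<exists>!y. P y) \<longleftrightarrow> (\<exists>!x. P (f x))"
proof -
  have "(\<exists>y. Q y) \<longleftrightarrow> (\<exists>x. Q (f x))" "(\<forall>y. Q y) \<longleftrightarrow> (\<forall>x. Q (f x))" for Q
    using bij_is_surj[OF assms] by (metis surj_def)+
  then show ?thesis
    unfolding Ex1_def by (simp add: inj_eq[OF bij_is_inj[OF assms]])
qed

text \<open>Adjoint and square root are defined by \<open>THE\<close> behind a test of unique
  existence. Together with \<open>ex1_bij_iff\<close> this transports them without deciding whether
  the test succeeds.\<close>

lemma the_bij_eq:
  assumes "bij f" "\<exists>!x. P (f x)"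
  shows "(THE y. P y) = f (THE x. P (f x))"
proof (rule the1_equality)
  show "\<exists>!y. P y"
    using assms ex1_bij_iff by blast
  show "P (f (THE x. P (f x)))"
    using assms(2) by (rule theI')
qed

section \<open>Classes of measurable functions\<close>

text \<open>On these classes \<open>l2_rep\<close> returns a genuine representative. Working here
  instead of in \<open>L2\<close> makes closure under the linear operations a matter of
  measurability alone.\<close>

definition measurable_classes :: "'a measure \<Rightarrow> 'a l2 set" where
  "measurable_classes M = l2_class M ` borel_measurable M"

lemma L2_subset_measurable_classes: "L2 M \<subseteq> measurable_classes M"
  by (auto simp: L2_def measurable_classes_def square_integrable_def)

lemma l2_class_cong_AE:
  assumes "AE x in M. f x = g x"
  shows "l2_class M f = l2_class M g"
proof -
  have "(AE x in M. h x = f x) \<longleftrightarrow> (AE x in M. h x = g x)" for h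
    using assms by (auto elim: eventually_elim2)
  then show ?thesis
    by (simp add: l2_class_def)
qed

text \<open>A measurable function lies in its own class, so \<open>l2_rep\<close> chooses from a
  nonempty set.\<close>

lemma l2_rep_mem: "u \<in> measurable_classes M \<Longrightarrow> l2_rep u \<in> u"
  unfolding l2_rep_def
  by (rule someI_ex[of "\<lambda>f. f \<in> u"]) (auto simp: measurable_classes_def l2_class_def)

lemma measurable_class_eq_AE:
  assumes "u \<in> measurable_classes M" "f \<in> u" "g \<in> u"
  shows "AE x in M. f x = g x"
proof -
  obtain h where "AE x in M. f x = h x" "AE x in M. g x = h x"
    using assms by (auto simp: measurable_classes_def l2_class_def)
  then show ?thesis
    by eventually_elim simp
qed

lemma l2_rep_measurable [measurable_dest]:
  "u \<in> measurable_classes M \<Longrightarrow> l2_rep u \<in> borel_measurable M"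
  using l2_rep_mem[of u M] by (auto simp: measurable_classes_def l2_class_def)

lemma l2_rep_l2_class_AE:
  assumes "f \<in> borel_measurable M"
  shows "AE x in M. l2_rep (l2_class M f) x = f x"
  using l2_rep_mem[of "l2_class M f" M] assms
  by (auto simp: measurable_classes_def l2_class_def)

lemma l2_class_in_measurable_classes:
  "f \<in> borel_measurable M \<Longrightarrow> l2_class M f \<in> measurable_classes M"
  by (simp add: measurable_classes_def)

lemma l2_add_in_measurable_classes:
  assumes [measurable]: "u \<in> measurable_classes M" "v \<in> measurable_classes M"
  shows "l2_add M u v \<in> measurable_classes M"
  unfolding l2_add_def by (rule l2_class_in_measurable_classes) measurable

lemma l2_diff_in_measurable_classes:
  assumes [measurable]: "u \<in> measurable_classes M" "v \<in> measurable_classes M"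
  shows "l2_diff M u v \<in> measurable_classes M"
  unfolding l2_diff_def by (rule l2_class_in_measurable_classes) measurable

lemma l2_scale_in_measurable_classes:
  assumes [measurable]: "u \<in> measurable_classes M"
  shows "l2_scale M c u \<in> measurable_classes M"
  unfolding l2_scale_def by (rule l2_class_in_measurable_classes) measurable

lemmas measurable_classes_closed =
  l2_add_in_measurable_classes l2_diff_in_measurable_classes l2_scale_in_measurable_classes

text \<open>Linearity is stated through \<open>l2_add\<close> and \<open>l2_scale\<close> only, so
  differences are reduced to them. The representative chosen for the negated class equals the
  negated representative almost everywhere.\<close>

lemma l2_diff_eq_add_scale:
  assumes [measurable]: "v \<in> measurable_classes M"
  shows "l2_diff M u v = l2_add M u (l2_scale M (-1) v)"
proof -
  have "AE x in M. l2_rep (l2_scale M (-1) v) x = - 1 * l2_rep v x"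
    unfolding l2_scale_def by (rule l2_rep_l2_class_AE) measurable
  then show ?thesis
    unfolding l2_diff_def l2_add_def
    by (intro l2_class_cong_AE) (auto elim: eventually_mono)
qed

text \<open>Needed for graph norms: the value of an operator at a difference is meaningful only
  inside the domain.\<close>

lemma linear_operator_l2_diff_mem_dom:
  assumes "linear_operator M B" "u \<in> dom B" "v \<in> dom B"
  shows "l2_diff M u v \<in> dom B"
proof -
  have "v \<in> measurable_classes M"
    using assms L2_subset_measurable_classes by (auto simp: linear_operator_def)
  moreover have "l2_scale M (-1) v \<in> dom B"
    using assms unfolding linear_operator_def by (metis domI)
  ultimately show ?thesis
    using assms unfolding linear_operator_def by (metis domI l2_diff_eq_add_scale)
qed

text \<open>The squared modulus is \<open>z * cnj z\<close>; hence invariance of the inner product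
  gives invariance of the norm.\<close>

lemma l2_norm_eq_inner: "l2_norm M u = sqrt (Re (l2_inner M u u))"
proof -
  have "l2_inner M u u = complex_of_real (LINT x|M. (cmod (l2_rep u x))\<^sup>2)"
    unfolding l2_inner_def by (simp only: complex_norm_square[symmetric] integral_complex_of_real)
  then show ?thesis
    by (simp add: l2_norm_def)
qed

section \<open>Transport along an isomorphism of measure spaces\<close>

text \<open>The maps are mutually inverse at every point, not merely almost everywhere, so that
  composition is a bijection on all functions, measurable or not.\<close>

locale measure_isomorphism =
  fixes M :: "'a measure" and N :: "'b measure"
    and \<phi> :: "'a \<Rightarrow> 'b" and \<psi> :: "'b \<Rightarrow> 'a"
  assumes measurable_phi [measurable]: "\<phi> \<in> M \<rightarrow>\<^sub>M N"
    and measurable_psi [measurable]: "\<psi> \<in> N \<rightarrow>\<^sub>M M"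
    and psi_phi [simp]: "\<And>x. \<psi> (\<phi> x) = x"
    and phi_psi [simp]: "\<And>y. \<phi> (\<psi> y) = y"
    and distr_phi: "distr M N \<phi> = N"
begin

lemma distr_psi: "distr N M \<psi> = M"
proof -
  have "distr N M \<psi> = distr (distr M N \<phi>) M \<psi>"
    by (simp only: distr_phi)
  also have "\<dots> = distr M M (\<psi> \<circ> \<phi>)"
    by (rule distr_distr) measurable
  finally show ?thesis
    by (simp add: comp_def)
qed

text \<open>\<open>AE_distrD\<close> transfers arbitrary predicates in one direction. Using it for
  \<phi> and for \<psi> gives the equivalence, for nonmeasurable \<open>P\<close> as well.\<close>

lemma AE_phi_iff: "(AE x in M. P (\<phi> x)) \<longleftrightarrow> (AE y in N. P y)"
proof
  assume "AE x in M. P (\<phi> x)"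
  then have "AE x in distr N M \<psi>. P (\<phi> x)"
    by (simp only: distr_psi)
  then have "AE y in N. P (\<phi> (\<psi> y))"
    by (rule AE_distrD[OF measurable_psi])
  then show "AE y in N. P y"
    by simp
next
  assume "AE y in N. P y"
  then have "AE y in distr M N \<phi>. P y"
    by (simp only: distr_phi)
  then show "AE x in M. P (\<phi> x)"
    by (rule AE_distrD[OF measurable_phi])
qed

lemma measurable_comp_psi_iff:
  "f \<circ> \<psi> \<in> borel_measurable N \<longleftrightarrow> f \<in> borel_measurable M"
proof
  assume "f \<circ> \<psi> \<in> borel_measurable N"
  then have "(f \<circ> \<psi>) \<circ> \<phi> \<in> borel_measurable M"
    by (rule measurable_comp[OF measurable_phi])
  then show "f \<in> borel_measurable M"
    by (simp add: comp_def)
qed (rule measurable_comp[OF measurable_psi])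

lemma integral_phi:
  fixes f :: "'b \<Rightarrow> 'c::{banach, second_countable_topology}"
  assumes "f \<in> borel_measurable N"
  shows "(LINT x|M. f (\<phi> x)) = (LINT y|N. f y)"
  using integral_distr[OF measurable_phi assms] by (simp add: distr_phi)

lemma integrable_phi_iff:
  fixes f :: "'b \<Rightarrow> 'c::{banach, second_countable_topology}"
  assumes "f \<in> borel_measurable N"
  shows "integrable M (\<lambda>x. f (\<phi> x)) \<longleftrightarrow> integrable N f"
  using integrable_distr_eq[OF measurable_phi assms] by (simp add: distr_phi)

subsection \<open>Transport of classes\<close>

text \<open>Acts on the whole set of functions and chooses no representative. This makes it a
  bijection of all sets of functions, with inverse \<open>pull\<close>.\<close>

definition push :: "'a l2 \<Rightarrow> 'b l2" where
  "push u = (\<lambda>f. f \<circ> \<psi>) ` u"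

definition pull :: "'b l2 \<Rightarrow> 'a l2" where
  "pull v = (\<lambda>g. g \<circ> \<phi>) ` v"

lemma pull_push [simp]: "pull (push u) = u"
  by (simp add: pull_def push_def image_image comp_def)

lemma push_pull [simp]: "push (pull v) = v"
  by (simp add: pull_def push_def image_image comp_def)

lemma bij_push: "bij push"
  by (rule o_bij[of pull]) (simp_all add: fun_eq_iff)

lemma push_eq_iff [simp]: "push u = push v \<longleftrightarrow> u = v"
  by (metis pull_push)

lemma mem_push_iff: "h \<in> push u \<longleftrightarrow> h \<circ> \<phi> \<in> u"
proof
  assume "h \<in> push u"
  then show "h \<circ> \<phi> \<in> u"
    by (auto simp: push_def comp_def)
next
  assume "h \<circ> \<phi> \<in> u"
  then have "(h \<circ> \<phi>) \<circ> \<psi> \<in> push u"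
    unfolding push_def by (rule imageI)
  then show "h \<in> push u"
    by (simp add: comp_def)
qed

text \<open>\<open>h\<close> belongs to the left side iff \<open>h \<circ> \<phi>\<close> is
  measurable and agrees with \<open>f\<close> almost everywhere; both conditions transfer to
  \<open>N\<close>.\<close>

lemma push_l2_class: "push (l2_class M f) = l2_class N (f \<circ> \<psi>)"
proof (rule set_eqI)
  fix h
  show "h \<in> push (l2_class M f) \<longleftrightarrow> h \<in> l2_class N (f \<circ> \<psi>)"
    unfolding mem_push_iff
    using measurable_comp_psi_iff[of "h \<circ> \<phi>"] AE_phi_iff[of "\<lambda>y. h y = f (\<psi> y)"]
    by (simp add: l2_class_def comp_def)
qed

lemma pull_l2_class: "pull (l2_class N g) = l2_class M (g \<circ> \<phi>)"
proof -
  have "push (l2_class M (g \<circ> \<phi>)) = l2_class N g"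
    by (simp add: push_l2_class comp_def)
  then show ?thesis
    by (metis pull_push)
qed

lemma square_integrable_comp_psi_iff:
  "square_integrable N (f \<circ> \<psi>) \<longleftrightarrow> square_integrable M f"
proof (cases "f \<in> borel_measurable M")
  case True
  then have "f \<circ> \<psi> \<in> borel_measurable N"
    by (simp only: measurable_comp_psi_iff)
  then have "(\<lambda>y. (cmod ((f \<circ> \<psi>) y))\<^sup>2) \<in> borel_measurable N"
    by measurable
  from integrable_phi_iff[OF this] True show ?thesis
    by (simp add: square_integrable_def measurable_comp_psi_iff)
\<comment> \<open>Without measurability of \<open>f\<close> both sides are false.\<close>
qed (simp add: square_integrable_def measurable_comp_psi_iff)

lemma L2_eq_push: "L2 N = push ` L2 M"
proof (intro set_eqI iffI)
  fix v assume "v \<in> L2 N"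
  then obtain g where g: "v = l2_class N g" "square_integrable N g"
    by (auto simp: L2_def)
  have "(g \<circ> \<phi>) \<circ> \<psi> = g"
    by (simp add: comp_def)
  then have "square_integrable M (g \<circ> \<phi>)" "v = push (l2_class M (g \<circ> \<phi>))"
    using g square_integrable_comp_psi_iff[of "g \<circ> \<phi>"] by (simp_all add: push_l2_class)
  then show "v \<in> push ` L2 M"
    unfolding L2_def by blast
next
  fix v assume "v \<in> push ` L2 M"
  then obtain f where "v = l2_class N (f \<circ> \<psi>)" "square_integrable N (f \<circ> \<psi>)"
    by (auto simp: L2_def push_l2_class square_integrable_comp_psi_iff)
  then show "v \<in> L2 N"
    unfolding L2_def by blast
qed

lemma push_in_L2_iff [simp]: "push u \<in> L2 N \<longleftrightarrow> u \<in> L2 M"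
  by (auto simp: L2_eq_push)

lemma push_image_subset_L2_iff: "push ` S \<subseteq> L2 N \<longleftrightarrow> S \<subseteq> L2 M"
  by (simp add: L2_eq_push inj_image_subset_iff[OF bij_is_inj[OF bij_push]])

lemma push_in_measurable_classes:
  "u \<in> measurable_classes M \<Longrightarrow> push u \<in> measurable_classes N"
  by (auto simp: measurable_classes_def push_l2_class measurable_comp_psi_iff)

text \<open>The choices made by \<open>l2_rep\<close> on the two spaces are unrelated, but both
  functions lie in the class \<open>push u\<close> and thus agree almost everywhere. All
  independence of representatives below rests on this.\<close>

lemma l2_rep_push_AE:
  assumes "u \<in> measurable_classes M"
  shows "AE y in N. l2_rep (push u) y = l2_rep u (\<psi> y)"
proof -
  have "l2_rep u \<circ> \<psi> \<in> push u"
    using l2_rep_mem[OF assms] by (auto simp: push_def)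
  from measurable_class_eq_AE[OF _ l2_rep_mem this] show ?thesis
    using push_in_measurable_classes[OF assms] by simp
qed

text \<open>Replacing a generating function by the chosen representative changes it on a null set of
  \<open>N\<close>, and \<phi> pulls this back to a null set of \<open>M\<close>.\<close>

lemma pullback_eq_pull:
  assumes "v \<in> L2 N"
  shows "pullback M \<phi> v = pull v"
proof -
  obtain g where g: "v = l2_class N g" "g \<in> borel_measurable N"
    using assms by (auto simp: L2_def square_integrable_def)
  have "AE y in N. l2_rep v y = g y"
    using l2_rep_l2_class_AE[OF g(2)] g(1) by simp
  then have "AE x in M. l2_rep v (\<phi> x) = g (\<phi> x)"
    using AE_phi_iff[of "\<lambda>y. l2_rep v y = g y"] by simp
  then have "l2_class M (l2_rep v \<circ> \<phi>) = l2_class M (g \<circ> \<phi>)"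
    by (intro l2_class_cong_AE) simp
  then show ?thesis
    by (simp add: pullback_def g(1) pull_l2_class)
qed

lemma inv_into_pullback:
  assumes "u \<in> L2 M"
  shows "inv_into (L2 N) (pullback M \<phi>) u = push u"
proof (rule inv_into_f_eq)
  show "inj_on (pullback M \<phi>) (L2 N)"
    by (rule inj_onI) (metis pullback_eq_pull push_pull)
qed (use assms in \<open>simp_all add: pullback_eq_pull\<close>)

lemma push_l2_zero: "push (l2_zero M) = l2_zero N"
  by (simp add: l2_zero_def push_l2_class comp_def)

lemma push_l2_add:
  assumes "u \<in> measurable_classes M" "v \<in> measurable_classes M"
  shows "push (l2_add M u v) = l2_add N (push u) (push v)"
  using l2_rep_push_AE[OF assms(1)] l2_rep_push_AE[OF assms(2)]
  unfolding l2_add_def push_l2_class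
  by (intro l2_class_cong_AE) (auto elim: eventually_elim2)

lemma push_l2_diff:
  assumes "u \<in> measurable_classes M" "v \<in> measurable_classes M"
  shows "push (l2_diff M u v) = l2_diff N (push u) (push v)"
  using l2_rep_push_AE[OF assms(1)] l2_rep_push_AE[OF assms(2)]
  unfolding l2_diff_def push_l2_class
  by (intro l2_class_cong_AE) (auto elim: eventually_elim2)

lemma push_l2_scale:
  assumes "u \<in> measurable_classes M"
  shows "push (l2_scale M c u) = l2_scale N c (push u)"
  using l2_rep_push_AE[OF assms]
  unfolding l2_scale_def push_l2_class
  by (intro l2_class_cong_AE) (erule eventually_mono, simp)

text \<open>Only finitely many representatives occur, so their exceptional null sets can be
  united.\<close>

lemma push_l2_lincomb:
  assumes "\<And>i. i < k \<Longrightarrow> e i \<in> measurable_classes M"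
  shows "push (l2_lincomb M k c e) = l2_lincomb N k c (\<lambda>i. push (e i))"
proof -
  have "AE y in N. \<forall>i\<in>{..<k}. l2_rep (push (e i)) y = l2_rep (e i) (\<psi> y)"
    using assms by (intro AE_finite_allI) (auto intro: l2_rep_push_AE)
  then show ?thesis
    unfolding l2_lincomb_def push_l2_class
    by (intro l2_class_cong_AE) (auto elim: eventually_mono)
qed

text \<open>Change of variables along \<phi>, then exchange of representatives that agree almost
  everywhere. Both steps ask only for measurable integrands.\<close>

lemma l2_inner_push:
  assumes "u \<in> measurable_classes M" "v \<in> measurable_classes M"
  shows "l2_inner N (push u) (push v) = l2_inner M u v"
proof -
  note [measurable] = assms[THEN l2_rep_measurable]
    assms[THEN push_in_measurable_classes, THEN l2_rep_measurable]
  have [measurable]: "cnj \<in> borel_measurable borel"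
    by (intro borel_measurable_continuous_onI continuous_intros)
  have "(\<lambda>y. l2_rep u (\<psi> y) * cnj (l2_rep v (\<psi> y))) \<in> borel_measurable N"
    by measurable
  from integral_phi[OF this]
  have "l2_inner M u v = (LINT y|N. l2_rep u (\<psi> y) * cnj (l2_rep v (\<psi> y)))"
    by (simp add: l2_inner_def)
  also have "\<dots> = l2_inner N (push u) (push v)"
    unfolding l2_inner_def
  proof (rule integral_cong_AE)
    show "AE y in N. l2_rep u (\<psi> y) * cnj (l2_rep v (\<psi> y)) =
        l2_rep (push u) y * cnj (l2_rep (push v) y)"
      using l2_rep_push_AE[OF assms(1)] l2_rep_push_AE[OF assms(2)] by eventually_elim simp
  qed measurable
  finally show ?thesis ..
qed

lemma l2_norm_push: "u \<in> measurable_classes M \<Longrightarrow> l2_norm N (push u) = l2_norm M u"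
  by (simp add: l2_norm_eq_inner l2_inner_push)

subsection \<open>Transport of operators\<close>

text \<open>Conjugation by \<open>push\<close>, defined on all partial maps. It is a bijection
  there, so statements quantifying over operators can be transported.\<close>

definition push_op :: "'a l2_op \<Rightarrow> 'b l2_op" where
  "push_op A = (\<lambda>v. map_option push (A (pull v)))"

lemma push_op_push: "push_op A (push u) = map_option push (A u)"
  by (simp add: push_op_def)

lemma push_op_eq_Some_iff [simp]: "push_op A (push u) = Some (push w) \<longleftrightarrow> A u = Some w"
  by (cases "A u") (simp_all add: push_op_push)

lemma bij_push_op: "bij push_op"
  by (rule o_bij[of "\<lambda>A' u. map_option pull (A' (push u))"])
    (simp_all add: fun_eq_iff push_op_def option.map_comp comp_def option.map_ident)

lemma dom_push_op: "dom (push_op A) = push ` dom A"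
proof (rule set_eqI)
  fix v
  have "push (pull v) \<in> dom (push_op A) \<longleftrightarrow> push (pull v) \<in> push ` dom A"
    unfolding domIff push_op_push inj_image_mem_iff[OF bij_is_inj[OF bij_push]] by simp
  then show "v \<in> dom (push_op A) \<longleftrightarrow> v \<in> push ` dom A"
    by simp
qed

lemma ran_push_op: "ran (push_op A) = push ` ran A"
proof (intro set_eqI iffI)
  fix w assume "w \<in> ran (push_op A)"
  then show "w \<in> push ` ran A"
    by (auto simp: ran_def push_op_def)
next
  fix w assume "w \<in> push ` ran A"
  then obtain u a where "w = push u" "A a = Some u"
    by (auto simp: ran_def)
  then have "push_op A (push a) = Some w"
    by (simp add: push_op_push)
  then show "w \<in> ran (push_op A)"
    by (rule ranI)
qed

lemma the_push_op: "u \<in> dom A \<Longrightarrow> the (push_op A (push u)) = push (the (A u))"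
  by (auto simp: push_op_push)

text \<open>On \<open>L2 N\<close> the pullback is \<open>pull\<close> and its inverse is
  \<open>push\<close>. Outside \<open>L2 N\<close> both sides are \<open>None\<close>, the right one
  because the domain of \<open>A\<close> lies in \<open>L2 M\<close>.\<close>

lemma transport_op_eq_push_op:
  assumes "dom A \<subseteq> L2 M" "ran A \<subseteq> L2 M"
  shows "transport_op M N \<phi> A = push_op A"
proof
  fix v
  show "transport_op M N \<phi> A v = push_op A v"
  proof (cases "v \<in> L2 N")
    case True
    have "map_option (inv_into (L2 N) (pullback M \<phi>)) (A (pull v)) = map_option push (A (pull v))"
      using assms(2) by (intro option.map_cong0 inv_into_pullback) (auto intro: ranI)
    then show ?thesis
      using True by (simp add: transport_op_def push_op_def pullback_eq_pull)
  next
    case False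
    then have "pull v \<notin> L2 M"
      by (metis push_in_L2_iff push_pull)
    then have "A (pull v) = None"
      using assms(1) by blast
    then show ?thesis
      using False by (simp add: transport_op_def push_op_def)
  qed
qed

end

section \<open>Invariance of linearity, adjoint, spectrum and eigenspaces\<close>

text \<open>Linearity is left out because it is itself a transported property, and because the
  locale is also applied to candidate square roots and to the empty map.\<close>

locale transported_operator = measure_isomorphism +
  fixes A :: "'a l2_op"
  assumes dom_L2: "dom A \<subseteq> L2 M" and ran_L2: "ran A \<subseteq> L2 M"
begin

lemma dom_measurable: "u \<in> dom A \<Longrightarrow> u \<in> measurable_classes M"
  using dom_L2 L2_subset_measurable_classes by blast

lemma the_L2: "u \<in> dom A \<Longrightarrow> the (A u) \<in> L2 M"
  using ran_L2 by (auto intro: ranI)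

lemma the_measurable: "u \<in> dom A \<Longrightarrow> the (A u) \<in> measurable_classes M"
  using the_L2 L2_subset_measurable_classes by blast

lemma L2_measurable: "u \<in> L2 M \<Longrightarrow> u \<in> measurable_classes M"
  using L2_subset_measurable_classes by blast

lemmas class_rules = dom_measurable the_measurable L2_measurable measurable_classes_closed

text \<open>Oriented so that simplification moves \<open>push\<close> outwards, until injectivity or
  the invariance of norm and inner product removes it.\<close>

lemmas push_rules =
  class_rules the_push_op l2_inner_push l2_norm_push
  push_l2_add[symmetric] push_l2_diff[symmetric] push_l2_scale[symmetric]

lemma linear_operator_push_op: "linear_operator N (push_op A) \<longleftrightarrow> linear_operator M A"
proof -
  have "push (l2_zero M) \<in> push ` dom A \<longleftrightarrow> l2_zero M \<in> dom A"
    by (simp add: inj_image_mem_iff[OF bij_is_inj[OF bij_push]])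
  then show ?thesis
    unfolding linear_operator_def dom_push_op ran_push_op push_image_subset_L2_iff
    by (simp add: push_rules push_l2_zero[symmetric] cong: ball_cong)
qed

lemma densely_defined_push_op: "densely_defined N (push_op A) \<longleftrightarrow> densely_defined M A"
  unfolding densely_defined_def dom_push_op L2_eq_push
  by (simp add: push_rules cong: ball_cong bex_cong)

lemma adjoint_op_push_op: "adjoint_op N (push_op A) = push_op (adjoint_op M A)"
proof -
  define P where "P g h \<longleftrightarrow> h \<in> L2 M \<and> (\<forall>f \<in> dom A. l2_inner M (the (A f)) g = l2_inner M f h)"
    for g h
  define Q where "Q g h \<longleftrightarrow> h \<in> L2 N \<and>
      (\<forall>f \<in> dom (push_op A). l2_inner N (the (push_op A f)) g = l2_inner N f h)" for g h
  \<comment> \<open>Invariance of the inner product needs measurable classes, hence the restriction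
    to \<open>L2 M\<close>.\<close>
  have QP: "Q (push g) (push h) \<longleftrightarrow> P g h" if "g \<in> L2 M" for g h
    using that unfolding P_def Q_def dom_push_op
    by (simp add: push_rules cong: conj_cong ball_cong)
  have adjM: "adjoint_op M A g = (if g \<in> L2 M \<and> (\<exists>!h. P g h) then Some (THE h. P g h) else None)" for g
    unfolding adjoint_op_def Let_def P_def ..
  have adjN: "adjoint_op N (push_op A) g =
      (if g \<in> L2 N \<and> (\<exists>!h. Q g h) then Some (THE h. Q g h) else None)" for g
    unfolding adjoint_op_def Let_def Q_def ..
  have "adjoint_op N (push_op A) (push g) = push_op (adjoint_op M A) (push g)" for g
  proof (cases "g \<in> L2 M")
    case True
    have "(\<exists>!h. Q (push g) h) \<longleftrightarrow> (\<exists>!h. P g h)"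
      using ex1_bij_iff[OF bij_push, of "Q (push g)"] by (simp add: QP True)
    moreover have "(THE h. Q (push g) h) = push (THE h. P g h)" if "\<exists>!h. P g h"
      using the_bij_eq[OF bij_push, of "Q (push g)"] that by (simp add: QP True)
    ultimately show ?thesis
      using True by (simp add: adjM adjN push_op_push)
  \<comment> \<open>For \<open>g\<close> outside \<open>L2 M\<close> both adjoints are
    undefined.\<close>
  qed (simp add: adjM adjN push_op_push)
  then show ?thesis
    by (metis ext push_pull)
qed

lemma self_adjoint_push_op: "self_adjoint N (push_op A) \<longleftrightarrow> self_adjoint M A"
  unfolding self_adjoint_def adjoint_op_push_op by (simp add: inj_eq[OF bij_is_inj[OF bij_push_op]])

text \<open>\<open>push\<close> intertwines the two maps \<open>z - A\<close>, carries
  \<open>L2 M\<close> bijectively onto \<open>L2 N\<close> and preserves norms, so bijectivity and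
  the bound on the inverse transfer.\<close>

lemma resolvent_set_push_op: "resolvent_set N (push_op A) = resolvent_set M A"
proof -
  define R where "R z f = l2_diff M (l2_scale M z f) (the (A f))" for z f
  have R: "l2_diff N (l2_scale N z (push f)) (the (push_op A (push f))) = push (R z f)"
    if "f \<in> dom A" for z f
    using that by (simp add: R_def push_rules)
  have "bij_betw (\<lambda>f. l2_diff N (l2_scale N z f) (the (push_op A f))) (push ` dom A) (push ` L2 M) \<longleftrightarrow>
      bij_betw (R z) (dom A) (L2 M)" for z
  proof -
    have push: "bij_betw push S (push ` S)" for S
      by (rule inj_on_imp_bij_betw) (simp add: inj_on_def)
    \<comment> \<open>Precompose with \<open>push\<close>, move it to the left of
      \<open>R z\<close>, then cancel it by injectivity.\<close>
    have "bij_betw (\<lambda>f. l2_diff N (l2_scale N z f) (the (push_op A f))) (push ` dom A) (push ` L2 M)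
        \<longleftrightarrow> bij_betw ((\<lambda>f. l2_diff N (l2_scale N z f) (the (push_op A f))) \<circ> push) (dom A) (push ` L2 M)"
      by (rule bij_betw_comp_iff[OF push])
    also have "\<dots> \<longleftrightarrow> bij_betw (push \<circ> R z) (dom A) (push ` L2 M)"
      by (rule bij_betw_cong) (simp add: R)
    also have "\<dots> \<longleftrightarrow> bij_betw (R z) (dom A) (L2 M)"
      unfolding bij_betw_def image_comp[symmetric] inj_image_eq_iff[OF bij_is_inj[OF bij_push]]
      by (simp add: inj_on_def)
    finally show ?thesis .
  qed
  moreover have "l2_norm N (push (R z f)) = l2_norm M (R z f)" if "f \<in> dom A" for z f
    using that by (simp add: R_def push_rules)
  ultimately show ?thesis
    unfolding resolvent_set_def dom_push_op L2_eq_push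
    by (simp add: R push_rules R_def[symmetric] cong: ball_cong)
qed

lemma spectrum_push_op: "spectrum N (push_op A) = spectrum M A"
  by (simp add: spectrum_def resolvent_set_push_op)

lemma eigenspace_push_op: "eigenspace N (push_op A) z = push ` eigenspace M A z"
proof -
  have "push f \<in> eigenspace N (push_op A) z \<longleftrightarrow> f \<in> eigenspace M A z" for f
    unfolding eigenspace_def dom_push_op mem_Collect_eq inj_image_mem_iff[OF bij_is_inj[OF bij_push]]
    by (simp add: push_rules cong: conj_cong)
  then show ?thesis
    by (metis (no_types, lifting) image_iff push_pull subsetI subset_antisym)
qed

end

section \<open>Dimension of subspaces and the positive square root\<close>

context measure_isomorphism
begin

lemma has_dimension_push:
  assumes "E \<subseteq> measurable_classes M"
  shows "has_dimension N (push ` E) k \<longleftrightarrow> has_dimension M E k"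
proof -
  define B where "B e \<longleftrightarrow> (\<forall>i<k. e i \<in> E) \<and>
      (\<forall>c. l2_lincomb M k c e = l2_zero M \<longrightarrow> (\<forall>i<k. c i = 0)) \<and>
      (\<forall>u \<in> E. \<exists>c. u = l2_lincomb M k c e)" for e
  define B' where "B' e \<longleftrightarrow> (\<forall>i<k. e i \<in> push ` E) \<and>
      (\<forall>c. l2_lincomb N k c e = l2_zero N \<longrightarrow> (\<forall>i<k. c i = 0)) \<and>
      (\<forall>u \<in> push ` E. \<exists>c. u = l2_lincomb N k c e)" for e
  have B': "B' (\<lambda>i. push (e i)) \<longleftrightarrow> B e" for e
  proof -
    have "(\<forall>i<k. push (e i) \<in> push ` E) \<longleftrightarrow> (\<forall>i<k. e i \<in> E)"
      by (simp add: inj_image_mem_iff[OF bij_is_inj[OF bij_push]])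
    \<comment> \<open>Valid only for families in \<open>E\<close>; \<open>conj_cong\<close> below
      supplies this from the first conjunct.\<close>
    moreover have "l2_lincomb N k c (\<lambda>i. push (e i)) = push (l2_lincomb M k c e)"
      if "\<forall>i<k. e i \<in> E" for c
      using that assms by (intro push_l2_lincomb[symmetric]) auto
    ultimately show ?thesis
      unfolding B_def B'_def by (simp add: push_l2_zero[symmetric] cong: conj_cong)
  qed
  have "(\<exists>e. B' e) \<longleftrightarrow> (\<exists>e. B e)"
  proof
    assume "\<exists>e. B' e"
    \<comment> \<open>Every family of classes on the second space is the \<open>push\<close> of its
      \<open>pull\<close>.\<close>
    then obtain e where "B' (\<lambda>i. push (pull (e i)))"
      by auto
    then show "\<exists>e. B e"
      unfolding B' by blast
  qed (use B' in blast)
  then show ?thesis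
    unfolding has_dimension_def B_def B'_def .
qed

text \<open>Conjugation commutes with composition of partial maps, and the other clauses are already
  transported. A candidate leaving \<open>L2\<close> fails to be a linear operator on both
  sides.\<close>

lemma is_positive_sqrt_push_op:
  "is_positive_sqrt N (push_op A) (push_op B) \<longleftrightarrow> is_positive_sqrt M A B"
proof (cases "dom B \<subseteq> L2 M \<and> ran B \<subseteq> L2 M")
  case True
  then interpret B: transported_operator M N \<phi> \<psi> B
    by unfold_locales auto
  have "push_op B \<circ>\<^sub>m push_op B = push_op (B \<circ>\<^sub>m B)"
    by (rule ext) (auto simp: map_comp_def push_op_def split: option.split)
  then show ?thesis
    unfolding is_positive_sqrt_def B.linear_operator_push_op B.densely_defined_push_op
      B.self_adjoint_push_op dom_push_op
    by (simp add: B.push_rules inj_eq[OF bij_is_inj[OF bij_push_op]] cong: ball_cong)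
next
  case False
  then have "\<not> (dom (push_op B) \<subseteq> L2 N \<and> ran (push_op B) \<subseteq> L2 N)"
    by (auto simp: dom_push_op ran_push_op image_subset_iff)
  then show ?thesis
    using False by (auto simp: is_positive_sqrt_def linear_operator_def)
qed

text \<open>Since \<open>push_op\<close> is bijective on all partial maps, unique existence holds on
  both sides or on neither; in the latter case both roots are the empty map, which
  \<open>push_op\<close> fixes.\<close>

lemma sqrt_op_push_op: "sqrt_op N (push_op A) = push_op (sqrt_op M A)"
proof -
  have ex: "(\<exists>!B. is_positive_sqrt N (push_op A) B) \<longleftrightarrow> (\<exists>!B. is_positive_sqrt M A B)"
    using ex1_bij_iff[OF bij_push_op, of "is_positive_sqrt N (push_op A)"]
    by (simp add: is_positive_sqrt_push_op)
  moreover have "(THE B. is_positive_sqrt N (push_op A) B) = push_op (THE B. is_positive_sqrt M A B)"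
    if "\<exists>!B. is_positive_sqrt M A B"
    using the_bij_eq[OF bij_push_op, of "is_positive_sqrt N (push_op A)"] that
    by (simp add: is_positive_sqrt_push_op)
  moreover have "push_op Map.empty = Map.empty"
    by (simp add: push_op_def)
  ultimately show ?thesis
    by (simp add: sqrt_op_def)
qed

end

text \<open>The default \<open>Map.empty\<close> is not linear, its domain lacking the zero class,
  so it stays as a separate case.\<close>

lemma sqrt_op_linear_or_empty: "linear_operator M (sqrt_op M A) \<or> sqrt_op M A = Map.empty"
  using theI'[of "is_positive_sqrt M A"] by (auto simp: sqrt_op_def is_positive_sqrt_def)

section \<open>Eigenvalue enumeration, dissipativity and spectral dimension\<close>

context transported_operator
begin

text \<open>As an equality of predicates this also identifies the descriptions in
  \<open>eigenvalue\<close>, with no appeal to uniqueness of the enumeration.\<close>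

lemma eigenvalue_enumeration_push_op:
  "eigenvalue_enumeration N (push_op A) = eigenvalue_enumeration M A"
proof -
  have "eigenspace M A z \<subseteq> measurable_classes M" for z
    using dom_measurable by (auto simp: eigenspace_def)
  then show ?thesis
    by (simp add: fun_eq_iff eigenvalue_enumeration_def eigenspace_push_op has_dimension_push)
qed

lemma dissipative_neg_push_op: "dissipative_neg N (push_op A) \<longleftrightarrow> dissipative_neg M A"
  unfolding dissipative_neg_def dom_push_op by (simp add: push_rules cong: ball_cong)

lemma discrete_nonneg_spectrum_push_op:
  "discrete_nonneg_spectrum N (push_op A) \<longleftrightarrow> discrete_nonneg_spectrum M A"
  by (simp add: discrete_nonneg_spectrum_def spectrum_push_op eigenvalue_enumeration_push_op)

lemma has_spectral_dimension_push_op: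
  "has_spectral_dimension N (push_op A) = has_spectral_dimension M A"
  by (simp add: fun_eq_iff has_spectral_dimension_def eigenvalue_count_def eigenvalue_def
      eigenvalue_enumeration_push_op)

end

section \<open>Transport along a homeomorphism\<close>

text \<open>The image under \<phi> of the support of \<open>f\<close> is compact, hence closed in a
  Hausdorff space, and contains the support of \<open>f \<circ> \<psi>\<close>.\<close>

lemma C_c_comp:
  fixes \<phi> :: "'a::t2_space \<Rightarrow> 'b::t2_space"
  assumes "continuous_on UNIV \<phi>" "continuous_on UNIV \<psi>"
    and "\<And>x. \<psi> (\<phi> x) = x" "\<And>y. \<phi> (\<psi> y) = y" "f \<in> C_c"
  shows "f \<circ> \<psi> \<in> C_c"
proof -
  have f: "continuous_on UNIV f" "compact (closure {x. f x \<noteq> 0})"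
    using assms(5) by (auto simp: C_c_def)
  have "compact (\<phi> ` closure {x. f x \<noteq> 0})"
    using f(2) assms(1) by (intro compact_continuous_image) (auto intro: continuous_on_subset)
  moreover have "{y. (f \<circ> \<psi>) y \<noteq> 0} \<subseteq> \<phi> ` closure {x. f x \<noteq> 0}"
  proof
    fix y assume "y \<in> {y. (f \<circ> \<psi>) y \<noteq> 0}"
    then have "\<psi> y \<in> closure {x. f x \<noteq> 0}"
      by (intro subsetD[OF closure_subset]) simp
    then show "y \<in> \<phi> ` closure {x. f x \<noteq> 0}"
      using assms(4) by (metis image_eqI)
  qed
  ultimately have "compact (closure {y. (f \<circ> \<psi>) y \<noteq> 0})"
    by (metis closure_minimal compact_Int_closed closed_closure compact_imp_closed inf.absorb_iff2)
  moreover have "continuous_on UNIV (f \<circ> \<psi>)"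
    using continuous_on_compose2[OF f(1) assms(2)] by (simp add: comp_def)
  ultimately show ?thesis
    by (simp add: C_c_def)
qed

locale homeomorphic_measure_isomorphism = measure_isomorphism M N \<phi> \<psi>
  for M :: "'a::t2_space measure" and N :: "'b::t2_space measure" and \<phi> \<psi> +
  assumes continuous_phi: "continuous_on UNIV \<phi>" and continuous_psi: "continuous_on UNIV \<psi>"
begin

text \<open>The left \<open>C_c\<close> lives on the second space and the right one on the
  first.\<close>

lemma C_c_eq: "C_c = (\<lambda>f. f \<circ> \<psi>) ` C_c"
proof (intro set_eqI iffI)
  fix g :: "'b \<Rightarrow> complex" assume "g \<in> C_c"
  then have "g \<circ> \<phi> \<in> C_c"
    using continuous_phi continuous_psi by (intro C_c_comp[of \<psi> \<phi>]) auto
  moreover have "g = (g \<circ> \<phi>) \<circ> \<psi>"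
    by (simp add: comp_def)
  ultimately show "g \<in> (\<lambda>f. f \<circ> \<psi>) ` C_c"
    by (intro image_eqI[of _ _ "g \<circ> \<phi>"])
next
  fix g :: "'b \<Rightarrow> complex" assume "g \<in> (\<lambda>f. f \<circ> \<psi>) ` C_c"
  then show "g \<in> C_c"
    using C_c_comp[OF continuous_phi continuous_psi] by auto
qed

text \<open>The disjunction is what \<open>sqrt_op\<close> guarantees. Approximants are transported
  by composition with \<psi>, which preserves the supremum distance and the graph norm.\<close>

lemma C_c_core_push_op:
  assumes "linear_operator M B \<or> B = Map.empty"
  shows "C_c_core N (push_op B) \<longleftrightarrow> C_c_core M B"
proof -
  interpret B: transported_operator M N \<phi> \<psi> B
    using assms by unfold_locales (auto simp: linear_operator_def)
  have dom: "l2_class N (g \<circ> \<psi>) \<in> push ` dom B \<longleftrightarrow> l2_class M g \<in> dom B" for g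
    by (simp add: push_l2_class[symmetric] inj_image_mem_iff[OF bij_is_inj[OF bij_push]])
  have "surj \<psi>"
    by (rule surjI[of _ \<phi>]) simp
  then have sup: "(SUP y. cmod ((f \<circ> \<psi>) y - (g \<circ> \<psi>) y)) = (SUP x. cmod (f x - g x))" for f g
    using image_image[of "\<lambda>x. cmod (f x - g x)" \<psi> UNIV] by simp
  have graph: "graph_norm N (push_op B) (l2_diff N (push u) (l2_class N (g \<circ> \<psi>))) =
      graph_norm M B (l2_diff M u (l2_class M g))"
    if "u \<in> dom B" "l2_class M g \<in> dom B" for u g
  proof -
    \<comment> \<open>The domain contains \<open>u\<close>, which rules out the empty map.\<close>
    have "linear_operator M B"
      using that assms by auto
    then have "l2_diff M u (l2_class M g) \<in> dom B"
      using that by (rule linear_operator_l2_diff_mem_dom)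
    moreover have "l2_diff N (push u) (l2_class N (g \<circ> \<psi>)) = push (l2_diff M u (l2_class M g))"
      using that by (simp add: push_l2_class[symmetric] push_l2_diff B.dom_measurable)
    ultimately show ?thesis
      by (simp add: graph_norm_def B.push_rules)
  qed
  show ?thesis
    unfolding C_c_core_def C_c_eq dom_push_op
    \<comment> \<open>Applied compositions are kept folded so that the supremum matches
      \<open>sup\<close>.\<close>
    by (simp add: dom sup graph del: comp_apply cong: ball_cong bex_cong conj_cong)
qed

lemma standing_assumptions_push_op:
  assumes "dom A \<subseteq> L2 M" "ran A \<subseteq> L2 M"
  shows "standing_assumptions N (push_op A) \<longleftrightarrow> standing_assumptions M A"
proof -
  interpret A: transported_operator M N \<phi> \<psi> A
    using assms by unfold_locales
  show ?thesis
    by (simp add: standing_assumptions_def A.densely_defined_push_op A.self_adjoint_push_op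
        A.discrete_nonneg_spectrum_push_op A.dissipative_neg_push_op sqrt_op_push_op
        C_c_core_push_op sqrt_op_linear_or_empty)
qed

end

text \<open>A homeomorphism is a Borel isomorphism, so the locales apply and
  \<open>transport_op\<close> becomes \<open>push_op\<close>. Both operators have the same predicate
  \<open>has_spectral_dimension\<close>, which settles existence and value of the dimension
  together.\<close>

theorem mainTheorem4:
  fixes M :: "'a::polish_space measure"
    and N :: "'b::polish_space measure"
    and \<phi> :: "'a \<Rightarrow> 'b"
    and A :: "'a l2_op"
  assumes "metric_measure_space M"
    and "metric_measure_space N"
    and "locally_compact_space (euclidean :: 'a topology)"
    and "locally_compact_space (euclidean :: 'b topology)"
    and "path_connected (UNIV :: 'a set)"
    and "path_connected (UNIV :: 'b set)"
    and "\<exists>x y :: 'a. x \<noteq> y"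
    and "\<exists>x y :: 'b. x \<noteq> y"
    and "measure_support M = UNIV"
    and "measure_support N = UNIV"
    and "homeomorphic_map euclidean euclidean \<phi>"
    and "distr M borel \<phi> = N"
    and "linear_operator M A"
  shows "(standing_assumptions M A \<longleftrightarrow> standing_assumptions N (transport_op M N \<phi> A)) \<and>
    (standing_assumptions M A \<longrightarrow>
       ((\<exists>d. has_spectral_dimension M A d) \<longleftrightarrow>
          (\<exists>d. has_spectral_dimension N (transport_op M N \<phi> A) d)) \<and>
       ((\<exists>d. has_spectral_dimension M A d) \<longrightarrow>
          spectral_dimension M A = spectral_dimension N (transport_op M N \<phi> A)))"
proof -
  obtain \<psi> where "homeomorphic_maps euclidean euclidean \<phi> \<psi>"
    using assms(11) homeomorphic_map_maps by blast
  then have cont: "continuous_on UNIV \<phi>" "continuous_on UNIV \<psi>"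
    and inv: "\<And>x. \<psi> (\<phi> x) = x" "\<And>y. \<phi> (\<psi> y) = y"
    by (auto simp: homeomorphic_maps_def)
  have sets: "sets M = sets borel" "sets N = sets borel"
    using assms(1,2) by (auto simp: metric_measure_space_def radon_measure_def)
  have "\<phi> \<in> M \<rightarrow>\<^sub>M N" "\<psi> \<in> N \<rightarrow>\<^sub>M M"
    using borel_measurable_continuous_onI[OF cont(1)] borel_measurable_continuous_onI[OF cont(2)]
    by (simp_all add: measurable_cong_sets[OF sets] measurable_cong_sets[OF sets(2) sets(1)])
  \<comment> \<open>The image measure depends on its target only through the \<sigma>-algebra, which
    is Borel for \<open>N\<close>.\<close>
  moreover have "distr M N \<phi> = N"
    using assms(12) sets(2) by (metis distr_cong)
  ultimately interpret homeomorphic_measure_isomorphism M N \<phi> \<psi>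
    using cont inv by unfold_locales auto
  have L2: "dom A \<subseteq> L2 M" "ran A \<subseteq> L2 M"
    using assms(13) by (auto simp: linear_operator_def)
  interpret A: transported_operator M N \<phi> \<psi> A
    using L2 by unfold_locales
  show ?thesis
    by (simp add: transport_op_eq_push_op L2 standing_assumptions_push_op
        A.has_spectral_dimension_push_op spectral_dimension_def)
qed

end
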